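(* Let $e$ and $p$ be primes such that $e\equiv 1\pmod 6$ and $p$ is semiprimitive modulo $e$. Let $A$ be a positive integer with $A\equiv\pm3\pmod 8$ such that (1) $A^2\equiv -3\pmod e$, and (2) one of the following holds: (2.1) $p=2$ and $v_2(A^2-9)$ is odd; (2.2) $p=3$, $A=3A'$ for an integer $A'$, and $v_3(A'-1)$ or $v_3(A'+1)$ is odd; (2.3) $p\ge 5$ and $v_p(A+3)$ or $v_p(A-3)$ is odd. Then there is no binary sequence $\mathbf a$ of period $n=\tfrac14(A^2+3)$ with $C_{\mathbf a}(t)=3$ for all $1\le t\le n-1$.
   Context: An integer $a$ is semiprimitive modulo $b$ if there is an integer $c$ with $a^c\equiv -1\pmod b$. For a prime $p$ and nonzero integer $m$, $v_p(m)$ is the exponent of the highest power of $p$ dividing $m$ ($v_p(0)=\infty$). A binary sequence of period $n$ is $\mathbf a=(a_0,a_1,\ldots)$ with $a_j\in\{-1,1\}$, $a_{j+n}=a_j$; $C_{\mathbf a}(t)=\sum_{i=0}^{n-1}a_ia_{i+t}$. *)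

theory Defs
  imports "HOL-Number_Theory.Number_Theory" "HOL-Library.Extended_Nat"
begin

text \<open>
  The exponent is a natural number. The next lemma shows that also allowing negative exponents,
  that is, powers of an inverse of \<open>a\<close> modulo \<open>b\<close>, gives the same notion.
\<close>

definition semiprimitive :: "int \<Rightarrow> int \<Rightarrow> bool" where
  "semiprimitive a b \<longleftrightarrow> (\<exists>c::nat. [a ^ c = -1] (mod b))"

lemma semiprimitive_if_inverse:
  fixes a a' b :: int and c :: nat
  assumes "[a * a' = 1] (mod b)" and "[a' ^ c = -1] (mod b)"
  shows "semiprimitive a b"
proof -
  have "[(a * a') ^ c = 1] (mod b)"
    using cong_pow[OF assms(1), of c] by simp
  moreover have "[(a * a') ^ c = a ^ c * (-1)] (mod b)"
    unfolding power_mult_distrib using assms(2) by (rule cong_scalar_left)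
  ultimately have "[a ^ c * (-1) = 1] (mod b)"
    using cong_sym cong_trans by blast
  then have "[a ^ c * (-1) * (-1) = 1 * (-1)] (mod b)"
    by (rule cong_scalar_right)
  then show ?thesis
    unfolding semiprimitive_def by auto
qed

text \<open>
  The library's \<^const>\<open>multiplicity\<close> is \<open>0\<close> at \<open>0\<close>, whereas the valuation of \<open>0\<close> is infinite.
\<close>

definition val :: "int \<Rightarrow> int \<Rightarrow> enat" where
  "val p m = (if m = 0 then \<infinity> else enat (multiplicity p m))"

text \<open>An infinite valuation is not odd.\<close>

definition odd_val :: "int \<Rightarrow> int \<Rightarrow> bool" where
  "odd_val p m \<longleftrightarrow> (\<exists>k::nat. val p m = enat k \<and> odd k)"

text \<open>The period \<open>n\<close> is not required to be the least one.\<close>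

definition binary_sequence :: "nat \<Rightarrow> (nat \<Rightarrow> int) \<Rightarrow> bool" where
  "binary_sequence n a \<longleftrightarrow> (\<forall>j. a j \<in> {-1, 1}) \<and> (\<forall>j. a (j + n) = a j)"

definition autocorrelation :: "nat \<Rightarrow> (nat \<Rightarrow> int) \<Rightarrow> nat \<Rightarrow> int" where
  "autocorrelation n a t = (\<Sum>i<n. a i * a (i + t))"

end

theory Submission
  imports Defs "HOL-Computational_Algebra.Polynomial"
begin

text \<open>
  Since \<open>e\<close> divides \<open>n\<close>, the polynomial \<open>P = (\<Sum>i<n. a i * X ^ i)\<close> taken modulo
  \<open>1 + X + \<dots> + X ^ (e - 1)\<close> satisfies \<open>P * conj P = n - 3\<close>. As \<open>p\<close> is semiprimitive modulo \<open>e\<close>,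
  conjugation is a power of the Frobenius map modulo \<open>p\<close>, so \<open>P * conj P\<close> being divisible by \<open>p\<close> forces
  \<open>P\<close> to be divisible by \<open>p\<close>. Dividing out, the exponent of \<open>p\<close> in \<open>n - 3\<close> drops by two at a time and
  hence is even. But \<open>4 * (n - 3) = (A - 3) * (A + 3)\<close>, and the hypotheses on valuations make it odd.
\<close>

section \<open>Frobenius congruences modulo a prime for integer polynomials\<close>

lemma prime_dvd_power_add:
  fixes x y :: "'a::comm_ring_1"
  assumes "prime q"
  shows "of_nat q dvd (x + y) ^ q - (x ^ q + y ^ q)"
proof -
  have q: "q > 0" using assms prime_gt_0_nat by blast
  have "(x + y) ^ q = (\<Sum>k\<le>q. of_nat (q choose k) * x ^ k * y ^ (q - k))"
    by (rule binomial_ring)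
  also have "{..q} = insert 0 (insert q {1..<q})" using q by auto
  also have "(\<Sum>k\<in>\<dots>. of_nat (q choose k) * x ^ k * y ^ (q - k))
      = y ^ q + x ^ q + (\<Sum>k\<in>{1..<q}. of_nat (q choose k) * x ^ k * y ^ (q - k))"
    using q by simp
  finally have "(x + y) ^ q - (x ^ q + y ^ q)
      = (\<Sum>k\<in>{1..<q}. of_nat (q choose k) * x ^ k * y ^ (q - k))" by simp
  moreover have "of_nat q dvd (of_nat (q choose k) :: 'a)" if "k \<in> {1..<q}" for k
  proof -
    have "q dvd (q choose k)" using dvd_choose_prime[of k q] assms that by auto
    then obtain j where "q choose k = q * j" by (rule dvdE)
    then show ?thesis by simp
  qed
  ultimately show ?thesis by (auto intro!: dvd_sum dvd_mult2)
qed

lemma diff_dvd_power_diff: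
  fixes x y :: "'a::comm_ring_1"
  shows "x - y dvd x ^ n - y ^ n"
  by (simp add: power_diff_sumr2)

lemma prime_dvd_fermat_int:
  assumes "prime q"
  shows "int q dvd a ^ q - a"
proof (cases "int q dvd a")
  case True
  then have "int q dvd a ^ q"
    using dvd_trans[OF _ dvd_power[of q a]] assms prime_gt_0_nat by blast
  with True show ?thesis by simp
next
  case False
  have "[a ^ (q - 1) = 1] (mod int q)"
  proof -
    define b where "b = nat (a mod int q)"
    have b: "[a = int b] (mod int q)" using assms prime_gt_0_nat by (simp add: b_def cong_def)
    then have "\<not> q dvd b" using False by (metis cong_dvd_iff int_dvd_int_iff)
    then have "[b ^ (q - 1) = 1] (mod q)" using fermat_theorem assms by blast
    then have "[int b ^ (q - 1) = 1] (mod int q)" by (metis cong_int_iff of_nat_1 of_nat_power)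
    then show ?thesis using b cong_pow cong_trans by blast
  qed
  then have "[a ^ (q - 1) * a = 1 * a] (mod int q)" by (rule cong_scalar_right)
  then show ?thesis using power_minus_mult[of q a] assms prime_gt_0_nat[of q]
    by (simp add: cong_iff_dvd_diff del: One_nat_def)
qed

abbreviation X :: "int poly" where "X \<equiv> [:0, 1:]"

lemma pcompose_power: "pcompose (P ^ n) Q = pcompose P Q ^ n"
  for P Q :: "'a::comm_semiring_1 poly"
  by (induction n) (simp_all add: pcompose_1 pcompose_mult)

text \<open>Induction on the coefficients: \<open>prime_dvd_power_add\<close> splits the constant
  term off from \<open>X * P\<close>, and Fermat's little theorem shows that raising the constant to
  the power \<open>q\<close> fixes it modulo \<open>q\<close>.\<close>

lemma frobenius_pcompose:
  fixes P :: "int poly"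
  assumes "prime q"
  shows "of_nat q dvd P ^ q - pcompose P (X ^ q)"
proof (induction P)
  case 0
  then show ?case using assms prime_gt_0_nat[of q] by (simp add: zero_power)
next
  case (pCons a P)
  have e: "pCons a P = [:a:] + X * P" by simp
  have 1: "of_nat q dvd (pCons a P) ^ q - ([:a:] ^ q + (X * P) ^ q)"
    unfolding e by (rule prime_dvd_power_add[OF assms])
  have 2: "of_nat q dvd [:a:] ^ q - [:a:]"
    using prime_dvd_fermat_int[OF assms, of a]
    by (simp add: of_nat_poly poly_const_pow)
  have 3: "of_nat q dvd X ^ q * (P ^ q - pcompose P (X ^ q))"
    using pCons.IH by (rule dvd_mult)
  have "(pCons a P) ^ q - pcompose (pCons a P) (X ^ q)
     = ((pCons a P) ^ q - ([:a:] ^ q + (X * P) ^ q)) + ([:a:] ^ q - [:a:]) + X ^ q * (P ^ q - pcompose P (X ^ q))"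
    by (simp only: pcompose_pCons power_mult_distrib algebra_simps)
  then show ?case using 1 2 3 by (simp only: dvd_add)
qed

lemma frobenius_power_pcompose:
  fixes P :: "int poly"
  assumes "prime q"
  shows "of_nat q dvd P ^ (q ^ k) - pcompose P (X ^ (q ^ k))"
proof (induction k)
  case 0
  then show ?case by simp
next
  case (Suc k)
  let ?R = "pcompose P (X ^ (q ^ k))"
  have "of_nat q dvd (P ^ (q ^ k)) ^ q - ?R ^ q"
    using Suc.IH diff_dvd_power_diff dvd_trans by blast
  moreover have "of_nat q dvd ?R ^ q - pcompose ?R (X ^ q)"
    by (rule frobenius_pcompose[OF assms])
  moreover have "pcompose ?R (X ^ q) = pcompose P (X ^ (q ^ Suc k))"
    by (simp flip: pcompose_assoc power_mult add: pcompose_power pcompose_pCons mult.commute)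
  ultimately have "of_nat q dvd ((P ^ (q ^ k)) ^ q - ?R ^ q) + (?R ^ q - pcompose P (X ^ (q ^ Suc k)))"
    by (metis dvd_add)
  then show ?case by (simp add: mult.commute flip: power_mult)
qed

text \<open>Carries congruences between powers of \<open>X\<close> over to the polynomials obtained
  by substituting these powers.\<close>

lemma diff_dvd_pcompose_diff:
  fixes P Q R :: "'a::comm_ring_1 poly"
  shows "Q - R dvd pcompose P Q - pcompose P R"
proof (induction P)
  case (pCons a P)
  have "pcompose (pCons a P) Q - pcompose (pCons a P) R
      = Q * (pcompose P Q - pcompose P R) + (Q - R) * pcompose P R"
    by (simp add: pcompose_pCons algebra_simps)
  then show ?case using pCons.IH by simp
qed simp

section \<open>Arithmetic of exponents modulo \<open>e\<close>\<close>

text \<open>For prime \<open>e\<close> this is the \<open>e\<close>-th cyclotomic polynomial, so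
  divisibility by it is vanishing at a primitive \<open>e\<close>-th root of unity.\<close>

definition cyc :: "nat \<Rightarrow> int poly" where
  "cyc e = (\<Sum>i<e. X ^ i)"

lemma X_minus_1_times_cyc: "(X - 1) * cyc e = X ^ e - 1"
  unfolding cyc_def by (rule power_diff_1_eq[symmetric])

text \<open>\<open>cyc e\<close> divides \<open>X ^ e - 1\<close>, so \<open>X ^ e\<close> acts as 1
  and only the residue of an exponent modulo \<open>e\<close> matters.\<close>

lemma cyc_dvd_X_power_diff:
  assumes "[N = M] (mod e)"
  shows "cyc e dvd X ^ N - X ^ M"
proof -
  have "cyc e dvd X ^ e - 1" by (metis X_minus_1_times_cyc dvd_triv_right)
  have gen: "cyc e dvd X ^ (M + e * k) - X ^ M" for M k
  proof -
    have "X ^ e - 1 dvd (X ^ e) ^ k - 1 ^ k" by (rule diff_dvd_power_diff)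
    with \<open>cyc e dvd X ^ e - 1\<close> have "cyc e dvd X ^ M * ((X ^ e) ^ k - 1 ^ k)"
      by (intro dvd_mult) (rule dvd_trans)
    moreover have "X ^ M * ((X ^ e) ^ k - 1 ^ k) = X ^ (M + e * k) - X ^ M"
      by (simp only: power_add power_mult right_diff_distrib power_one mult_1_right)
    ultimately show ?thesis by simp
  qed
  show ?thesis
  proof (cases "M \<le> N")
    case True
    then obtain k where "N = M + e * k"
      using assms cong_le_nat[of M N e] by (auto simp: mult.commute add.commute)
    then show ?thesis using gen by simp
  next
    case False
    then obtain k where "M = N + e * k"
      using assms cong_le_nat[of N M e] by (auto simp: mult.commute add.commute cong_sym_eq)
    then show ?thesis using gen[of N k] by (metis dvd_minus_iff minus_diff_eq)
  qed
qed

lemma cyc_dvd_pcompose_diff: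
  assumes "[N = M] (mod e)"
  shows "cyc e dvd pcompose P (X ^ N) - pcompose P (X ^ M)"
  using cyc_dvd_X_power_diff[OF assms] diff_dvd_pcompose_diff dvd_trans by blast

text \<open>After multiplication by \<open>X - 1\<close> this becomes the fact that
  \<open>X ^ e - 1\<close> divides \<open>X ^ (e * k) - 1\<close>. It later makes the constant part
  of the autocorrelation vanish modulo \<open>cyc e\<close>.\<close>

lemma cyc_dvd_cyc_mult: "cyc e dvd cyc (e * k)"
proof -
  have "(X - 1) * cyc (e * k) = (X ^ e) ^ k - 1 ^ k" by (simp add: X_minus_1_times_cyc power_mult)
  then have "X ^ e - 1 dvd (X - 1) * cyc (e * k)" using diff_dvd_power_diff by metis
  then have "(X - 1) * cyc e dvd (X - 1) * cyc (e * k)" by (simp add: X_minus_1_times_cyc)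
  moreover have "X - 1 \<noteq> 0" by (simp add: one_pCons)
  ultimately show ?thesis using dvd_mult_cancel_left by blast
qed

section \<open>Ideals with two generators\<close>

text \<open>Expresses that \<open>u\<close> is zero in the quotient by the ideal
  \<open>(f, g)\<close>. With \<open>f = cyc e\<close> and \<open>g = q\<close> the quotient is the
  ring in which conjugation is compared with Frobenius.\<close>

definition in_ideal :: "'a::comm_ring_1 \<Rightarrow> 'a \<Rightarrow> 'a \<Rightarrow> bool" where
  "in_ideal f g u \<longleftrightarrow> (\<exists>r s. u = f * r + g * s)"

lemma in_ideal_left: "f dvd u \<Longrightarrow> in_ideal f g u"
  unfolding in_ideal_def by (metis add.right_neutral dvdE mult_zero_right)

lemma in_ideal_right: "g dvd u \<Longrightarrow> in_ideal f g u"
  unfolding in_ideal_def by (metis add.left_neutral dvdE mult_zero_right)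

lemma in_ideal_add:
  assumes "in_ideal f g u" "in_ideal f g v"
  shows "in_ideal f g (u + v)"
proof -
  obtain r s r' s' where "u = f * r + g * s" "v = f * r' + g * s'"
    using assms unfolding in_ideal_def by blast
  then have "u + v = f * (r + r') + g * (s + s')" by (simp add: algebra_simps)
  then show ?thesis unfolding in_ideal_def by blast
qed

lemma in_ideal_mult:
  assumes "in_ideal f g u"
  shows "in_ideal f g (u * w)"
proof -
  obtain r s where "u = f * r + g * s"
    using assms unfolding in_ideal_def by blast
  then have "u * w = f * (r * w) + g * (s * w)" by (simp add: algebra_simps)
  then show ?thesis unfolding in_ideal_def by blast
qed

lemma in_ideal_diff:
  assumes "in_ideal f g u" "in_ideal f g v"
  shows "in_ideal f g (u - v)"
  using in_ideal_add[OF assms(1) in_ideal_mult[OF assms(2), of "-1"]] by simp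

section \<open>Conjugation and norms modulo \<open>cyc e\<close> and \<open>q\<close>\<close>

text \<open>
  Modulo \<open>X ^ e - 1\<close> this is the substitution of \<open>X\<close> by its inverse, that is, complex conjugation
  on the \<open>e\<close>-th cyclotomic ring.
\<close>

abbreviation conj_poly :: "nat \<Rightarrow> int poly \<Rightarrow> int poly" where
  "conj_poly e P \<equiv> pcompose P (X ^ (e - 1))"

text \<open>
  With \<open>N = q ^ c\<close>, Frobenius gives \<open>P ^ N = conj_poly e P\<close>, so \<open>P ^ (N + 1)\<close> is the norm and vanishes
  modulo the ideal; but \<open>P ^ (N * N) = P\<close> there, so the quotient ring has no nilpotents.
\<close>

lemma in_ideal_norm_imp:
  assumes q: "prime q" and c: "[int q ^ c = -1] (mod int e)" and e: "e > 2"
    and norm: "in_ideal (cyc e) (of_nat q) (P * conj_poly e P)"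
  shows "in_ideal (cyc e) (of_nat q) P"
proof -
  let ?I = "in_ideal (cyc e) (of_nat q)"
  define N where "N = q ^ c"
  \<comment> \<open>At \<open>c = 0\<close> the assumption would read 1 = -1 modulo
    \<open>e\<close>, impossible for \<open>e > 2\<close>.\<close>
  have "c \<noteq> 0"
  proof
    assume "c = 0"
    with c have "int e dvd 2" by (simp add: cong_iff_dvd_diff)
    with e show False using zdvd_imp_le by fastforce
  qed
  then have "N \<ge> 2" unfolding N_def
    using prime_ge_2_nat[OF q] self_le_power[of q c] by linarith
  \<comment> \<open>The bound \<open>N + 1 \<le> N * N\<close> is what lets
    \<open>P ^ (N + 1)\<close> be multiplied up to \<open>P ^ (N * N)\<close> below.\<close>
  then have "N + 1 \<le> 2 * N" by simp
  also have "\<dots> \<le> N * N" using \<open>N \<ge> 2\<close> by (rule mult_right_mono) simp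
  finally have le: "N + 1 \<le> N * N" .
  have cN: "[int N = -1] (mod int e)" using c by (simp add: N_def)
  then have "int e dvd int N + 1" by (simp add: cong_iff_dvd_diff)
  then have "int e dvd int N + 1 - int e" by simp
  then have N1: "[N = e - 1] (mod e)"
    using e by (simp add: cong_iff_dvd_diff of_nat_diff algebra_simps flip: cong_int_iff)
  have "[int N * int N = (-1) * (-1)] (mod int e)" by (intro cong_mult cN)
  then have N2: "[N * N = 1] (mod e)" by (simp flip: cong_int_iff)
  have "?I (P * (P ^ N - pcompose P (X ^ N)))"
    unfolding N_def by (intro in_ideal_right dvd_mult frobenius_power_pcompose[OF q])
  moreover have "?I (P * (pcompose P (X ^ N) - conj_poly e P))"
    by (intro in_ideal_left dvd_mult cyc_dvd_pcompose_diff N1)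
  \<comment> \<open>The three terms telescope to \<open>P * P ^ N\<close>.\<close>
  ultimately have "?I (P * conj_poly e P + P * (P ^ N - pcompose P (X ^ N))
      + P * (pcompose P (X ^ N) - conj_poly e P))"
    using norm by (intro in_ideal_add)
  then have "?I (P ^ (N + 1))" by (simp add: algebra_simps)
  then have "?I (P ^ (N + 1) * P ^ (N * N - (N + 1)))" by (rule in_ideal_mult)
  then have 1: "?I (P ^ (N * N))" using le by (simp only: le_add_diff_inverse flip: power_add)
  have 2: "?I (P ^ (N * N) - pcompose P (X ^ (N * N)))"
    using frobenius_power_pcompose[OF q, of P "c + c"]
    by (intro in_ideal_right) (simp add: N_def power_add)
  have 3: "?I (pcompose P (X ^ (N * N)) - pcompose P (X ^ 1))"
    by (intro in_ideal_left cyc_dvd_pcompose_diff N2)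
  \<comment> \<open>The terms cancel down to the substitution of \<open>X ^ 1\<close>, which is
    \<open>P\<close> itself.\<close>
  have "?I (P ^ (N * N) - (P ^ (N * N) - pcompose P (X ^ (N * N)))
      - (pcompose P (X ^ (N * N)) - pcompose P (X ^ 1)))"
    by (intro in_ideal_diff 1 2 3)
  then show ?thesis by simp
qed

text \<open>Makes conjugation well defined modulo \<open>cyc e\<close>. Modulo \<open>e\<close> the
  exponent \<open>(e - 1) * i\<close> is \<open>e - i\<close>, and as \<open>i\<close> runs below
  \<open>e\<close> the latter runs through 1 to \<open>e\<close>, giving
  \<open>X * cyc e\<close>.\<close>

lemma cyc_dvd_conj_cyc:
  assumes "e > 0"
  shows "cyc e dvd conj_poly e (cyc e)"
proof -
  have 1: "conj_poly e (cyc e) = (\<Sum>i<e. X ^ ((e - 1) * i))"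
    by (simp add: cyc_def pcompose_sum pcompose_power pcompose_pCons flip: power_mult)
  have 2: "X * cyc e = (\<Sum>i<e. X ^ (e - i))"
  proof -
    have "cyc e = (\<Sum>i<e. X ^ (e - Suc i))"
      unfolding cyc_def by (rule sum.nat_diff_reindex[symmetric])
    then have "X * cyc e = (\<Sum>i<e. X * X ^ (e - Suc i))" by (simp only: sum_distrib_left)
    also have "\<dots> = (\<Sum>i<e. X ^ (e - i))"
      by (intro sum.cong refl) (simp only: lessThan_iff Suc_diff_Suc flip: power_Suc)
    finally show ?thesis .
  qed
  have "cyc e dvd X ^ ((e - 1) * i) - X ^ (e - i)" if "i < e" for i
  proof (rule cyc_dvd_X_power_diff)
    have "int ((e - 1) * i) - int (e - i) = int e * (int i - 1)"
      using that by (simp add: of_nat_diff algebra_simps)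
    then show "[(e - 1) * i = e - i] (mod e)"
      by (simp only: cong_iff_dvd_diff dvd_triv_left flip: cong_int_iff)
  qed
  then have "cyc e dvd conj_poly e (cyc e) - X * cyc e"
    unfolding 1 2 by (auto simp flip: sum_subtractf intro!: dvd_sum)
  then show ?thesis by (metis diff_add_cancel dvd_add dvd_triv_right)
qed

section \<open>Descent on the power of \<open>q\<close> in the norm\<close>

text \<open>The constant \<open>q\<close> is a prime element of the polynomial ring and does not
  divide \<open>cyc e\<close>, whose constant coefficient is 1; hence it must divide the
  cofactor.\<close>

lemma cyc_dvd_cancel:
  assumes q: "prime q" and e: "e > 0" and dvd: "cyc e dvd of_nat q * Y"
  shows "cyc e dvd Y"
proof -
  have "coeff ((X - 1) * cyc e) 0 = coeff (X ^ e - 1) 0" by (simp only: X_minus_1_times_cyc)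
  then have "coeff (cyc e) 0 = 1" using e by (simp add: coeff_mult coeff_0_power zero_power)
  then have nd: "\<not> [:int q:] dvd cyc e"
    using prime_gt_1_nat[OF q] by (auto simp: const_poly_dvd_iff intro!: exI[of _ 0])
  have pe: "prime_elem [:int q:]"
    using q by (simp add: prime_elem_const_poly_iff)
  obtain Z where Z: "[:int q:] * Y = cyc e * Z" using dvd by (auto simp: of_nat_poly)
  then have "[:int q:] dvd cyc e * Z" by (metis dvd_triv_left)
  with nd have "[:int q:] dvd Z" using pe prime_elem_dvd_multD by blast
  then obtain Z' where "Z = [:int q:] * Z'" by blast
  with Z have "[:int q:] * Y = [:int q:] * (cyc e * Z')" by (simp only: mult.left_commute)
  then have "Y = cyc e * Z'" using pe by (metis mult_cancel_left prime_elem_not_zeroI)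
  then show ?thesis by simp
qed

text \<open>Brings divisibility by \<open>q\<close> modulo \<open>cyc e\<close> back to the
  integers. Multiplying by \<open>X - 1\<close> replaces \<open>cyc e\<close> by
  \<open>X ^ e - 1\<close>; comparing coefficients then shows that those of the cofactor
  \<open>Z\<close> at multiples of \<open>e\<close> all agree modulo \<open>q\<close>, so they are
  zero modulo \<open>q\<close> since \<open>Z\<close> has finite degree.\<close>

lemma dvd_constant_if_cyc_dvd:
  assumes e: "e \<ge> 2" and dvd: "cyc e dvd of_nat q * Y - of_int m"
  shows "int q dvd m"
proof -
  obtain Z where "of_nat q * Y - of_int m = cyc e * Z" using dvd by blast
  then have "(X - 1) * (of_nat q * Y - of_int m) = (X - 1) * cyc e * Z" by (simp only: mult.assoc)
  also have "\<dots> = (monom 1 e - 1) * Z" by (simp add: X_minus_1_times_cyc monom_altdef)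
  finally have eq: "monom 1 e * Z - Z = [:int q:] * ((X - 1) * Y) - [:-m, m:]"
    by (simp add: of_nat_poly of_int_poly one_pCons algebra_simps)
  then have coeff: "coeff (monom 1 e * Z) i - coeff Z i = int q * coeff ((X - 1) * Y) i - coeff [:-m, m:] i" for i
  proof -
    have "coeff (monom 1 e * Z - Z) i = coeff ([:int q:] * ((X - 1) * Y) - [:-m, m:]) i"
      by (simp only: eq)
    moreover have "[:int q:] * ((X - 1) * Y) = smult (int q) ((X - 1) * Y)" by simp
    ultimately show ?thesis by (simp only: coeff_diff coeff_smult)
  qed
  have step: "[coeff Z (k * e) = coeff Z (Suc k * e)] (mod int q)" for k
  proof -
    \<comment> \<open>The polynomial \<open>[:-m, m:]\<close> is \<open>m * (X - 1)\<close>; since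
      \<open>e\<close> is at least 2, no positive multiple of \<open>e\<close> meets its
      coefficients at 0 and 1.\<close>
    have "Suc k * e \<ge> 2" using e by simp
    then have "coeff [:-m, m:] (Suc k * e) = 0"
      by (intro coeff_eq_0) (auto intro: le_less_trans[OF degree_pCons_le])
    then have "coeff Z (k * e) - coeff Z (Suc k * e) = int q * coeff ((X - 1) * Y) (Suc k * e)"
      using coeff[of "Suc k * e"] by (simp add: coeff_monom_mult)
    then show ?thesis by (simp add: cong_iff_dvd_diff)
  qed
  have "[coeff Z 0 = coeff Z (k * e)] (mod int q)" for k
  proof (induction k)
    case (Suc k)
    then show ?case using step cong_trans by blast
  qed simp
  \<comment> \<open>This choice of \<open>k\<close> puts the index \<open>k * e\<close> beyond the
    degree of \<open>Z\<close>.\<close>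
  from this[of "Suc (degree Z)"] have "int q dvd coeff Z 0"
    using mult_le_mono2[of 1 e "Suc (degree Z)"] e by (simp add: coeff_eq_0 cong_0_iff)
  moreover have "m = - (coeff Z 0) - int q * coeff ((X - 1) * Y) 0"
    using coeff[of 0] e by (simp add: coeff_monom_mult)
  ultimately show ?thesis by simp
qed

text \<open>By \<open>in_ideal_norm_imp\<close>, \<open>P\<close> is \<open>q * S\<close> modulo
  \<open>cyc e\<close>. Conjugation fixes integers, so the norm of \<open>P\<close> is
  \<open>q ^ 2\<close> times that of \<open>S\<close>, and one factor \<open>q\<close>
  cancels.\<close>

lemma norm_descent:
  assumes q: "prime q" and c: "[int q ^ c = -1] (mod int e)" and e: "e > 2"
    and norm: "cyc e dvd P * conj_poly e P - of_nat q * T"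
  obtains S where "cyc e dvd of_nat q * (S * conj_poly e S) - T"
proof -
  have "in_ideal (cyc e) (of_nat q) ((P * conj_poly e P - of_nat q * T) + of_nat q * T)"
    by (rule in_ideal_add[OF in_ideal_left[OF norm] in_ideal_right]) simp
  then have "in_ideal (cyc e) (of_nat q) (P * conj_poly e P)"
    by (simp only: diff_add_cancel)
  then have "in_ideal (cyc e) (of_nat q) P"
    by (rule in_ideal_norm_imp[OF q c e])
  then obtain R S where P: "P = cyc e * R + of_nat q * S"
    unfolding in_ideal_def by blast
  let ?R = "conj_poly e R" and ?S = "conj_poly e S" and ?C = "conj_poly e (cyc e)"
  have "conj_poly e (of_nat q) = of_nat q" by (simp add: of_nat_poly pcompose_const)
  then have cP: "conj_poly e P = ?C * ?R + of_nat q * ?S"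
    by (simp only: P pcompose_add pcompose_mult)
  have "of_nat q * (of_nat q * (S * ?S) - T)
      = (P * conj_poly e P - of_nat q * T) - cyc e * (R * conj_poly e P) - ?C * (of_nat q * S * ?R)"
    unfolding cP unfolding P by (simp only: algebra_simps)
  moreover have "cyc e dvd \<dots>"
    using cyc_dvd_conj_cyc[of e] e by (intro dvd_diff norm dvd_triv_left dvd_mult2) simp
  ultimately have "cyc e dvd of_nat q * (of_nat q * (S * ?S) - T)" by (simp only:)
  then have "cyc e dvd of_nat q * (S * ?S) - T"
    by (rule cyc_dvd_cancel[OF q, rotated]) (use e in simp)
  then show thesis by (rule that)
qed

text \<open>Each descent followed by one more cancellation lowers the exponent by two. At exponent 1
  the descent alone leaves \<open>m\<close> equal to a multiple of \<open>q\<close> modulo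
  \<open>cyc e\<close>.\<close>

lemma dvd_if_norm_eq_odd_power:
  assumes q: "prime q" and c: "[int q ^ c = -1] (mod int e)" and e: "e > 2"
    and norm: "cyc e dvd P * conj_poly e P - of_nat q ^ (2 * j + 1) * of_int m"
  shows "int q dvd m"
  using norm
proof (induction j arbitrary: P)
  case (0 P)
  then have "cyc e dvd P * conj_poly e P - of_nat q * of_int m" by simp
  from norm_descent[OF q c e this] obtain S
    where "cyc e dvd of_nat q * (S * conj_poly e S) - of_int m" .
  then show ?case by (rule dvd_constant_if_cyc_dvd[rotated]) (use e in simp)
next
  case (Suc j P)
  then have "cyc e dvd P * conj_poly e P - of_nat q * (of_nat q * (of_nat q ^ (2 * j + 1) * of_int m))"
    by (simp add: mult.assoc)
  from norm_descent[OF q c e this] obtain S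
    where "cyc e dvd of_nat q * (S * conj_poly e S) - of_nat q * (of_nat q ^ (2 * j + 1) * of_int m)" .
  then have "cyc e dvd of_nat q * (S * conj_poly e S - of_nat q ^ (2 * j + 1) * of_int m)"
    by (simp only: right_diff_distrib)
  then have "cyc e dvd S * conj_poly e S - of_nat q ^ (2 * j + 1) * of_int m"
    by (rule cyc_dvd_cancel[OF q, rotated]) (use e in simp)
  then show ?case by (rule Suc.IH)
qed

section \<open>The norm of a sequence polynomial and its autocorrelation\<close>

lemma bij_betw_add_mod: "bij_betw (\<lambda>t. (j + t) mod n) {..<n} {..<n::nat}"
proof -
  have "inj_on (\<lambda>t. (j + t) mod n) {..<n}"
  proof (rule inj_onI)
    fix s t assume st: "s \<in> {..<n}" "t \<in> {..<n}" and eq: "(j + s) mod n = (j + t) mod n"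
    then have "[s = t] (mod n)" by (metis cong_add_lcancel_nat cong_def)
    with st show "s = t" by (simp add: cong_def)
  qed
  moreover have "(\<lambda>t. (j + t) mod n) ` {..<n} \<subseteq> {..<n}" by auto
  ultimately show ?thesis
    by (simp add: bij_betw_def endo_inj_surj)
qed

lemma periodic_mod:
  fixes a :: "nat \<Rightarrow> 'a"
  assumes "\<And>j. a (j + n) = a j"
  shows "a (i mod n) = a i"
proof -
  have "a (i + n * k) = a i" for i k
  proof (induction k)
    case (Suc k)
    then show ?case using assms[of "i + n * k"] by (simp add: algebra_simps)
  qed simp
  from this[of "i mod n" "i div n"] show ?thesis by simp
qed

text \<open>In the double sum over \<open>i\<close> and \<open>j\<close>, put
  \<open>i = (j + t) mod n\<close>. Since \<open>e\<close> divides \<open>n\<close>, reduction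
  modulo \<open>n\<close> preserves exponents modulo \<open>e\<close>, and
  \<open>(e - 1) * j\<close> acts as \<open>-j\<close>, leaving \<open>X ^ t\<close>.\<close>

lemma cyc_dvd_norm_minus_autocorrelation:
  assumes period: "\<And>j. a (j + n) = a j" and e: "e dvd n" "e > 0"
  defines "P \<equiv> \<Sum>i<n. of_int (a i) * X ^ i"
  shows "cyc e dvd P * conj_poly e P - (\<Sum>t<n. of_int (autocorrelation n a t) * X ^ t)"
proof -
  have "conj_poly e P = (\<Sum>j<n. of_int (a j) * X ^ ((e - 1) * j))"
    by (simp add: P_def pcompose_sum pcompose_smult pcompose_power pcompose_pCons
        of_int_poly flip: power_mult)
  then have "P * conj_poly e P
      = (\<Sum>j<n. \<Sum>i<n. of_int (a i * a j) * X ^ (i + (e - 1) * j))"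
    unfolding P_def
    by (subst sum.swap) (simp add: sum_product power_add mult_ac)
  also have "\<dots> = (\<Sum>j<n. \<Sum>t<n. of_int (a ((j + t) mod n) * a j) * X ^ ((j + t) mod n + (e - 1) * j))"
    by (intro sum.cong refl sum.reindex_bij_betw[OF bij_betw_add_mod, symmetric])
  finally have norm: "P * conj_poly e P
      = (\<Sum>j<n. \<Sum>t<n. of_int (a j * a (j + t)) * X ^ ((j + t) mod n + (e - 1) * j))"
    by (simp add: periodic_mod[of a n, OF period] mult.commute)
  have corr: "(\<Sum>t<n. of_int (autocorrelation n a t) * X ^ t)
      = (\<Sum>j<n. \<Sum>t<n. of_int (a j * a (j + t)) * X ^ t)"
    by (subst sum.swap) (simp add: autocorrelation_def sum_distrib_right)
  have "cyc e dvd of_int (a j * a (j + t)) * X ^ ((j + t) mod n + (e - 1) * j)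
      - of_int (a j * a (j + t)) * X ^ t" for j t
  proof -
    have "[(j + t) mod n + (e - 1) * j = (j + t) + (e - 1) * j] (mod e)"
      using e by (intro cong_add cong_refl) (simp add: cong_def mod_mod_cancel)
    also have "(j + t) + (e - 1) * j = t + e * j"
      using e by (cases e) simp_all
    also have "[t + e * j = t] (mod e)" by (simp add: cong_def)
    finally show ?thesis
      by (simp only: flip: right_diff_distrib) (intro dvd_mult cyc_dvd_X_power_diff)
  qed
  then show ?thesis
    unfolding norm corr by (simp only: flip: sum_subtractf) (intro dvd_sum)
qed

text \<open>Subtracting \<open>l * cyc n\<close>, a multiple of \<open>cyc e\<close>, from the
  autocorrelation polynomial removes every term except the one at shift 0.\<close>

lemma cyc_dvd_norm_minus_constant:
  assumes period: "\<And>j. a (j + n) = a j" and e: "e dvd n" "e > 0" and n: "n > 0"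
    and l: "\<And>t. 1 \<le> t \<Longrightarrow> t < n \<Longrightarrow> autocorrelation n a t = l"
  defines "P \<equiv> \<Sum>i<n. of_int (a i) * X ^ i"
  shows "cyc e dvd P * conj_poly e P - of_int (autocorrelation n a 0 - l)"
proof -
  let ?C = "\<Sum>t<n. of_int (autocorrelation n a t) * X ^ t"
  have "?C - of_int l * cyc n = (\<Sum>t<n. of_int (autocorrelation n a t - l) * X ^ t)"
    unfolding cyc_def by (simp add: sum_distrib_left sum_subtractf left_diff_distrib)
  also have "\<dots> = (\<Sum>t<n. if t = 0 then of_int (autocorrelation n a 0 - l) else 0)"
    using l by (intro sum.cong) (auto simp: Suc_le_eq)
  also have "\<dots> = of_int (autocorrelation n a 0 - l)" using n by simp
  finally have "P * conj_poly e P - of_int (autocorrelation n a 0 - l)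
      = (P * conj_poly e P - ?C) + of_int l * cyc n" by (simp add: algebra_simps)
  moreover have "cyc e dvd P * conj_poly e P - ?C"
    unfolding P_def by (rule cyc_dvd_norm_minus_autocorrelation[of a n e, OF period e])
  moreover have "cyc e dvd cyc n" using e cyc_dvd_cyc_mult by blast
  ultimately show ?thesis by (simp only: dvd_add dvd_mult)
qed

section \<open>Parity of the exponent of \<open>p\<close> in \<open>n - 3\<close>\<close>

lemma odd_val_imp: "odd_val p m \<Longrightarrow> odd (multiplicity p m)"
  by (auto simp: odd_val_def val_def split: if_splits)

text \<open>An odd multiplicity is positive, so \<open>p\<close> divides that factor; by
  \<open>diff\<close> it does not divide the other, which contributes nothing.\<close>

lemma odd_multiplicity_mult:
  fixes p x y :: int
  assumes p: "prime p" and diff: "\<not> p dvd x - y"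
    and odd: "odd (multiplicity p x) \<or> odd (multiplicity p y)"
  shows "odd (multiplicity p (x * y))"
proof -
  have *: "odd (multiplicity p (u * v))"
    if u: "odd (multiplicity p u)" and "\<not> p dvd u - v" for u v
  proof -
    have "p dvd u" using u not_dvd_imp_multiplicity_0[of p u] by fastforce
    with that(2) have "\<not> p dvd v" by (metis dvd_diff)
    then have "multiplicity p (v * u) = multiplicity p u"
      using p by (intro multiplicity_prime_elem_times_other prime_imp_prime_elem)
    with u show ?thesis by (simp add: mult.commute)
  qed
  have "\<not> p dvd y - x" using diff by (metis dvd_minus_iff minus_diff_eq)
  with odd diff show ?thesis using *[of x y] *[of y x] by (auto simp: mult.commute)
qed

lemma odd_multiplicity_times_self_twice:
  fixes p x :: int
  assumes "prime p"
  shows "odd (multiplicity p (p * (p * x))) \<longleftrightarrow> odd (multiplicity p x)"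
proof (cases "x = 0")
  case False
  have "p \<noteq> 0" "\<not> is_unit p" using assms by auto
  with False show ?thesis by (simp add: multiplicity_times_same)
qed simp

lemma not_dvd_power_of_prime:
  fixes p r :: int
  assumes "prime p" "prime r" "p \<noteq> r"
  shows "\<not> p dvd r ^ k"
  using assms prime_dvd_power primes_dvd_imp_eq by blast

text \<open>In \<open>4 * (N - 3) = (A + 3) * (A - 3)\<close> the factor 4 is prime to odd
  \<open>p\<close> and a square at \<open>p = 2\<close>, so it never changes the parity.\<close>

lemma odd_multiplicity_period_minus_3:
  fixes p A N :: int
  assumes p: "prime p"
    and val: "(p = 2 \<and> odd_val 2 (A\<^sup>2 - 9)) \<or>
         (p = 3 \<and> (\<exists>A'. A = 3 * A' \<and> (odd_val 3 (A' - 1) \<or> odd_val 3 (A' + 1)))) \<or>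
         (p \<ge> 5 \<and> (odd_val p (A + 3) \<or> odd_val p (A - 3)))"
    and N: "4 * N = A\<^sup>2 + 3"
  shows "odd (multiplicity p (N - 3))"
proof -
  have N3: "2 ^ 2 * (N - 3) = (A + 3) * (A - 3)"
    using N by (simp add: algebra_simps power2_eq_square)
  have cancel: "multiplicity p (2 ^ 2 * (N - 3)) = multiplicity p (N - 3)" if "p \<noteq> 2"
  proof (rule multiplicity_prime_elem_times_other)
    show "prime_elem p" using p by (rule prime_imp_prime_elem)
    show "\<not> p dvd 2 ^ 2" using that by (intro not_dvd_power_of_prime[OF p]) simp_all
  qed
  from val consider "p = 2" "odd_val 2 (A\<^sup>2 - 9)"
    | A' where "p = 3" "A = 3 * A'" "odd_val 3 (A' + 1) \<or> odd_val 3 (A' - 1)"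
    | "p \<ge> 5" "odd_val p (A + 3) \<or> odd_val p (A - 3)"
    by blast
  then show ?thesis
  proof cases
    case 1
    have eq: "A\<^sup>2 - 9 = 2 * (2 * (N - 3))" using N by simp
    show ?thesis
      using odd_val_imp[OF 1(2)] odd_multiplicity_times_self_twice[OF p] 1(1) by (simp only: eq simp_thms)
  next
    case 2
    \<comment> \<open>The two factors differ by 2, which 3 does not divide.\<close>
    have "odd (multiplicity 3 ((A' + 1) * (A' - 1)))"
      using 2(3) by (intro odd_multiplicity_mult) (auto dest: odd_val_imp)
    then have "odd (multiplicity 3 (3 * (3 * ((A' + 1) * (A' - 1)))))"
      using odd_multiplicity_times_self_twice[OF p] 2(1) by simp
    moreover have "2 ^ 2 * (N - 3) = 3 * (3 * ((A' + 1) * (A' - 1)))"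
      unfolding N3 2(2) by (simp add: algebra_simps)
    ultimately show ?thesis using cancel 2(1) by simp
  next
    case 3
    have "\<not> p dvd 2" "\<not> p dvd 3" using 3(1) zdvd_imp_le[of p 2] zdvd_imp_le[of p 3] by auto
    \<comment> \<open>The number 6 is the difference of \<open>A + 3\<close> and
      \<open>A - 3\<close>.\<close>
    then have "\<not> p dvd 2 * 3" using p by (simp only: prime_dvd_mult_iff simp_thms)
    then have "odd (multiplicity p ((A + 3) * (A - 3)))"
      using 3(2) by (intro odd_multiplicity_mult p) (auto dest: odd_val_imp)
    then show ?thesis using cancel 3(1) by (simp only: N3) simp
  qed
qed

theorem theorem4p4:
  fixes e p A :: int and n :: nat
  assumes "prime e" and "prime p"
    and "[e = 1] (mod 6)"
    and "semiprimitive p e"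
    and "A > 0"
    and "[A = 3] (mod 8) \<or> [A = -3] (mod 8)"
    and "[A\<^sup>2 = -3] (mod e)"
    and "(p = 2 \<and> odd_val 2 (A\<^sup>2 - 9)) \<or>
         (p = 3 \<and> (\<exists>A'. A = 3 * A' \<and> (odd_val 3 (A' - 1) \<or> odd_val 3 (A' + 1)))) \<or>
         (p \<ge> 5 \<and> (odd_val p (A + 3) \<or> odd_val p (A - 3)))"
    and "4 * int n = A\<^sup>2 + 3"
  shows "\<not> (\<exists>a. binary_sequence n a \<and>
              (\<forall>t. 1 \<le> t \<and> t \<le> n - 1 \<longrightarrow> autocorrelation n a t = 3))"
proof
  assume "\<exists>a. binary_sequence n a \<and>
              (\<forall>t. 1 \<le> t \<and> t \<le> n - 1 \<longrightarrow> autocorrelation n a t = 3)"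
  then obtain a where a: "binary_sequence n a"
    and corr: "\<And>t. 1 \<le> t \<Longrightarrow> t \<le> n - 1 \<Longrightarrow> autocorrelation n a t = 3" by blast
  obtain q where q: "p = int q" "prime q"
    using prime_ge_0_int[OF assms(2)] assms(2) by (auto elim!: nonneg_int_cases)
  obtain E where E: "e = int E"
    using prime_ge_0_int[OF assms(1)] by (rule nonneg_int_cases)
  have "e > 1" using assms(1) by (rule prime_gt_1_int)
  then have "e mod 6 = 1" using assms(3) by (simp add: cong_def)
  with \<open>e > 1\<close> have "e > 2" and "odd e" by presburger+
  have "A\<^sup>2 + 3 > 0" by (rule add_nonneg_pos) simp_all
  then have "n > 0" using assms(9) by simp
  \<comment> \<open>Here \<open>A\<^sup>2 = -3\<close> modulo \<open>e\<close> enters; the factor 4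
    then cancels because \<open>e\<close> is odd.\<close>
  have "e dvd (2 * 2) * int n" using assms(7,9) by (simp add: cong_iff_dvd_diff)
  moreover have "coprime e (2 * 2)"
    using \<open>odd e\<close> by (simp only: coprime_mult_right_iff coprime_right_2_iff_odd simp_thms)
  ultimately have "e dvd int n" by (simp only: coprime_dvd_mult_right_iff)
  then have "E dvd n" by (simp add: E)
  obtain c where c: "[int q ^ c = -1] (mod int E)"
    using assms(4) by (auto simp: semiprimitive_def q E)
  have period: "\<And>j. a (j + n) = a j" and "\<And>j. a j \<in> {-1, 1}"
    using a by (auto simp: binary_sequence_def)
  then have "a i * a i = 1" for i by (metis insertE mult_1 mult_minus1 minus_minus singletonD)
  then have C0: "autocorrelation n a 0 = int n" by (simp add: autocorrelation_def)
  define P where "P = (\<Sum>i<n. of_int (a i) * X ^ i)"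
  have norm: "cyc E dvd P * conj_poly E P - of_int (int n - 3)"
    unfolding P_def C0[symmetric]
    by (rule cyc_dvd_norm_minus_constant[of a n E 3, OF period \<open>E dvd n\<close>])
      (use \<open>n > 0\<close> \<open>e > 2\<close> corr in \<open>auto simp: E\<close>)
  have odd: "odd (multiplicity p (int n - 3))"
    by (rule odd_multiplicity_period_minus_3[OF assms(2,8,9)])
  \<comment> \<open>The library's multiplicity of 0 is 0, which is even, so oddness rules out
    \<open>n = 3\<close>.\<close>
  then have ne: "int n - 3 \<noteq> 0" by (metis even_zero multiplicity_zero)
  obtain m where m: "int n - 3 = p ^ multiplicity p (int n - 3) * m" "\<not> p dvd m"
    using multiplicity_decompose'[of "int n - 3" p] ne assms(2) by (metis not_prime_unit)
  obtain j where "multiplicity p (int n - 3) = 2 * j + 1" using odd by (rule oddE)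
  with m(1) have "of_int (int n - 3) = (of_nat q ^ (2 * j + 1) * of_int m :: int poly)"
    by (metis of_int_mult of_int_of_nat_eq of_int_power q(1))
  then have "int q dvd m"
    using dvd_if_norm_eq_odd_power[OF q(2) c] norm \<open>e > 2\<close> E by (metis of_nat_less_iff of_nat_numeral)
  with m(2) q(1) show False by simp
qed

end
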